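(* There exist sequences $M,N\in\mathcal{LC}$ such that $\mu_p\le C\nu_p$ for some $C\ge1$ and all $p\in\mathbb{N}$, $M$ satisfies (mg), $\gamma(M,N)>0$, and $$\gamma(M)=\gamma(N)=\gamma(\omega_M)=\gamma(\omega_N)=0.$$ Moreover, $\gamma(M,N)$ can be made as large as desired, i.e. for every $R>0$ such $M,N$ can be found with $\gamma(M,N)\ge R$.
   Context: $\mathbb{N}=\{0,1,2,\dots\}$. For a sequence $M=(M_k)_{k\in\mathbb{N}}$ of positive reals put $\mu_0:=1$, $\mu_k:=M_k/M_{k-1}$ for $k\ge1$; $\nu_k$ denotes the quotients of $N$. $\mathcal{LC}$ is the set of all sequences $M$ of positive reals that are normalized ($1=M_0\le M_1$), log-convex ($M_j^2\le M_{j-1}M_{j+1}$ for all $j\ge1$) and satisfy $\lim_{k\to\infty}(M_k)^{1/k}=+\infty$. $M$ satisfies (mg) if there is $C\ge1$ with $M_{j+k}\le C^{j+k}M_jM_k$ for all $j,k\in\mathbb{N}$. If $\mu_p\le C\nu_p$ for all $p$: condition $(M,N)_{\gamma_r}$ ($r>0$) means $\sup_{p\ge1}\frac{(\mu_p)^{1/r}}{p}\sum_{k\ge p}\left(\frac{1}{\nu_k}\right)^{1/r}<+\infty$, and $\gamma(M,N):=\sup\{r>0:(M,N)_{\gamma_r}\text{ holds}\}\in[0,+\infty]$; for $M\in\mathcal{LC}$, $\gamma(M)=\gamma(M,M)$. For $M\in\mathcal{LC}$: $\omega_M(t):=\sup_{p\in\mathbb{N}}\log\left(\frac{t^p}{M_p}\right)$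 for $t>0$, $\omega_M(0):=0$. For a continuous nondecreasing $\omega:[0,\infty)\to[0,\infty)$ with $\omega(0)=0$ and $\omega(t)\to\infty$: $\gamma(\omega)$ is the supremum of all $r>0$ such that there is $C>0$ with $\int_1^\infty\frac{\omega(tu)}{u^{1+1/r}}\,du\le C\omega(t)+C$ for all $t\ge0$. All suprema over the empty set are $0$. *)

theory Defs
  imports "HOL-Analysis.Analysis"
begin

definition mquot :: "(nat \<Rightarrow> real) \<Rightarrow> nat \<Rightarrow> real" where
  "mquot M k = (if k = 0 then 1 else M k / M (k - 1))"

definition LC :: "(nat \<Rightarrow> real) set" where
  "LC = {M. (\<forall>k. M k > 0) \<and> M 0 = 1 \<and> 1 \<le> M 1 \<and>
            (\<forall>j\<ge>1. (M j)\<^sup>2 \<le> M (j - 1) * M (j + 1)) \<and>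
            filterlim (\<lambda>k. root k (M k)) at_top sequentially}"

definition moderate_growth :: "(nat \<Rightarrow> real) \<Rightarrow> bool" where
  "moderate_growth M \<longleftrightarrow> (\<exists>C\<ge>1. \<forall>j k. M (j + k) \<le> C ^ (j + k) * M j * M k)"

text \<open>The series and the supremum below are taken in \<^typ>\<open>ennreal\<close>, so a divergent
  series has the value \<^term>\<open>\<infinity> :: ennreal\<close> and makes the condition fail.\<close>

definition gamma_cond :: "(nat \<Rightarrow> real) \<Rightarrow> (nat \<Rightarrow> real) \<Rightarrow> real \<Rightarrow> bool" where
  "gamma_cond M N r \<longleftrightarrow>
     (SUP p\<in>{1..}. ennreal (mquot M p powr (1 / r) / real p) *
        (\<Sum>k. ennreal ((1 / mquot N (p + k)) powr (1 / r)))) < \<infinity>"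

text \<open>The growth indices take values in \<^typ>\<open>ennreal\<close>, where the supremum of the empty
  set is 0.\<close>

definition gamma_mixed :: "(nat \<Rightarrow> real) \<Rightarrow> (nat \<Rightarrow> real) \<Rightarrow> ennreal" where
  "gamma_mixed M N = (SUP r\<in>{r. r > 0 \<and> gamma_cond M N r}. ennreal r)"

definition gamma_seq :: "(nat \<Rightarrow> real) \<Rightarrow> ennreal" where
  "gamma_seq M = gamma_mixed M M"

text \<open>For \<open>M \<in> LC\<close> the supremum below is over a set that is bounded above, so the
  supremum on the reals is the true one.\<close>

definition omega :: "(nat \<Rightarrow> real) \<Rightarrow> real \<Rightarrow> real" where
  "omega M t = (if t > 0 then (SUP p. ln (t ^ p / M p)) else 0)"

text \<open>Intended for continuous nondecreasing \<open>w\<close> on \<open>[0, \<infinity>)\<close> with \<open>w 0 = 0\<close> and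
  \<open>w t \<rightarrow> \<infinity>\<close>; the values of \<open>w\<close> on negative reals are not used. As the integrand
  is then nonnegative, the integral is taken with values in \<^typ>\<open>ennreal\<close>, so that a
  divergent integral violates the bound.\<close>

definition gamma_weight :: "(real \<Rightarrow> real) \<Rightarrow> ennreal" where
  "gamma_weight w = (SUP r\<in>{r. r > 0 \<and>
     (\<exists>C>0. \<forall>t\<ge>0. (\<integral>\<^sup>+u\<in>{1..}. ennreal (w (t * u) / u powr (1 + 1 / r)) \<partial>lborel)
                    \<le> ennreal (C * w t + C))}. ennreal r)"

end

theory Submission
  imports Defs "HOL-Real_Asymp.Real_Asymp"
begin

text \<open>A sequence whose quotients take a constant value \<open>c\<close> on stretches \<open>{a<..b}\<close> with
  \<open>b\<close> arbitrarily large compared to \<open>a * (1 + ln c)\<close> has growth index 0, since the sum in the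
  index condition at \<open>p = a + 1\<close> contains \<open>b - a\<close> equal terms (\<open>not_gamma_cond\<close>). Its weight has
  index 0 as well: at \<open>c\<close> it is at most \<open>a * ln c\<close>, but at \<open>c * u\<close> it is at least \<open>b * ln u\<close>
  (\<open>omega_integral_unbounded\<close>). Both sequences below have such
  stretches; the mixed condition nevertheless holds because the larger sequence is already large
  where the smaller one is flat.

  Take the break points \<open>b\<^sub>j = 2 ^ 4 ^ j\<close>. The function \<open>slow\<close> is constant on
  \<open>[b\<^sub>j, b\<^sub>j\<^sup>2]\<close> and proportional to \<open>k\<^sup>2\<close> on \<open>[b\<^sub>j\<^sup>2, b\<^sub>j\<^sub>+\<^sub>1]\<close>, where \<open>b\<^sub>j\<^sub>+\<^sub>1 = b\<^sub>j\<^sup>4\<close>. It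
  satisfies \<open>slow m / slow k \<le> (m / k)\<^sup>2\<close> for \<open>1 \<le> k \<le> m\<close>, which gives moderate growth. The function
  \<open>steps\<close> is constant on each \<open>{b\<^sub>j<..b\<^sub>j\<^sub>+\<^sub>1}\<close>, with value \<open>slow b\<^sub>j\<^sub>+\<^sub>1\<close>, so that it
  majorizes \<open>slow\<close>. One such stretch contributes at most
  \<open>b\<^sub>j\<^sub>+\<^sub>1 / slow b\<^sub>j\<^sub>+\<^sub>1 = 1 / slow b\<^sub>j\<close> to the sum of \<open>1 / steps k\<close>. These contributions
  decrease at least geometrically, and \<open>1 / slow b\<^sub>j \<le> p / slow p\<close> for \<open>p\<close> in the stretch, hence
  the sum of \<open>1 / steps k\<close> over \<open>k \<ge> p\<close> is at most \<open>4 * p / slow p\<close>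
  (\<open>suminf_steps_le\<close>). This is the mixed condition with exponent 1 for quotients \<open>slow\<close> and
  \<open>steps\<close>, and with exponent \<open>n\<close> for their \<open>n\<close>-th powers. The other properties survive
  passing to powers, so a large \<open>n\<close> proves the theorem.\<close>

section \<open>Sequences with prescribed quotients\<close>

text \<open>The sequence with initial term 1 and quotients \<open>q 1, q 2, \<dots>\<close>; the value \<open>q 0\<close> is not
  used.\<close>

definition seq_of :: "(nat \<Rightarrow> real) \<Rightarrow> nat \<Rightarrow> real" where
  "seq_of q k = (\<Prod>i=1..k. q i)"

lemma seq_of_0 [simp]: "seq_of q 0 = 1"
  by (simp add: seq_of_def)

lemma seq_of_Suc [simp]: "seq_of q (Suc k) = seq_of q k * q (Suc k)"
  by (simp add: seq_of_def)

text \<open>The quotient sequences \<open>q\<close> of the elements of \<^const>\<open>LC\<close>. The value at 0 is fixed by the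
  convention in \<^const>\<open>mquot\<close>, and unboundedness of \<open>q\<close> makes the \<open>k\<close>-th root of the \<open>k\<close>-th
  term tend to infinity.\<close>

locale quotients =
  fixes q :: "nat \<Rightarrow> real"
  assumes q0: "q 0 = 1"
    and mono_q: "mono q"
    and unbounded_q: "\<And>K. \<exists>m. K \<le> q m"
begin

lemma q_ge_1: "1 \<le> q i"
  using monoD[OF mono_q, of 0 i] q0 by simp

lemma q_pos: "0 < q i"
  using q_ge_1[of i] by linarith

lemma seq_of_pos: "0 < seq_of q k"
  unfolding seq_of_def using q_pos by (intro prod_pos) auto

lemma mquot_seq_of: "mquot (seq_of q) = q"
proof
  fix k
  show "mquot (seq_of q) k = q k"
    using seq_of_pos[of "k - 1"] by (cases k) (auto simp: mquot_def q0)
qed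

lemma power_le_seq_of:
  assumes "1 \<le> t" and "\<And>i. m < i \<Longrightarrow> t \<le> q i"
  shows "t ^ (p - m) \<le> seq_of q p"
proof (induction p)
  case (Suc p)
  show ?case
  proof (cases "m \<le> p")
    case True
    have "t ^ (p - m) * t \<le> seq_of q p * q (Suc p)"
      using Suc assms True seq_of_pos[of p] by (intro mult_mono) auto
    then show ?thesis using True by (simp add: Suc_diff_le mult.commute)
  next
    case False
    have "1 * 1 \<le> seq_of q p * q (Suc p)"
      using Suc False q_ge_1 seq_of_pos[of p] by (intro mult_mono) auto
    then show ?thesis using False by simp
  qed
qed simp

lemma seq_of_le_power:
  assumes "\<And>i. i \<le> p \<Longrightarrow> q i \<le> c"
  shows "seq_of q p \<le> c ^ p"
proof -
  have "(\<Prod>i=1..p. q i) \<le> (\<Prod>i=1..p. c)"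
    using assms q_pos by (intro prod_mono) (auto intro: less_imp_le)
  then show ?thesis by (simp add: seq_of_def)
qed

lemma ratio_le:
  assumes "1 \<le> t" and "\<And>i. m < i \<Longrightarrow> t \<le> q i"
  shows "t ^ p / seq_of q p \<le> t ^ m"
proof -
  have "t ^ p \<le> t ^ (m + (p - m))"
    using assms(1) by (intro power_increasing) auto
  also have "t ^ (p - m) \<le> seq_of q p" using assms by (rule power_le_seq_of)
  then have "t ^ (m + (p - m)) \<le> t ^ m * seq_of q p"
    using assms(1) by (simp add: power_add)
  finally show ?thesis
    using seq_of_pos[of p] by (simp add: divide_simps)
qed

lemma eventually_ge:
  obtains m where "\<And>i. m < i \<Longrightarrow> K \<le> q i"
proof -
  obtain m where "K \<le> q m" using unbounded_q by blast
  then have "K \<le> q i" if "m < i" for i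
    using monoD[OF mono_q, of m i] that by simp
  then show ?thesis using that by blast
qed

lemma filterlim_root_seq_of: "filterlim (\<lambda>k. root k (seq_of q k)) at_top sequentially"
proof (subst filterlim_at_top_ge[where c = 1], intro allI impI)
  fix K :: real assume K: "1 \<le> K"
  \<comment> \<open>The square compensates for the first \<open>m\<close> quotients: for \<open>k \<ge> 2 * m\<close> at least half of the
    \<open>k\<close> factors are at least \<open>K\<^sup>2\<close>.\<close>
  obtain m where m: "\<And>i. m < i \<Longrightarrow> K\<^sup>2 \<le> q i" using eventually_ge[where K = "K\<^sup>2"] by blast
  have "K \<le> root k (seq_of q k)" if k: "2 * m + 1 \<le> k" for k
  proof -
    have "K ^ k \<le> K ^ (2 * (k - m))" using k K by (intro power_increasing) auto
    also have "\<dots> = (K\<^sup>2) ^ (k - m)" by (simp add: power_mult)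
    also have "\<dots> \<le> seq_of q k"
      using m K by (intro power_le_seq_of) auto
    finally have "root k (K ^ k) \<le> root k (seq_of q k)"
      using k by (intro real_root_le_mono) auto
    then show ?thesis using k K by (simp add: real_root_power_cancel)
  qed
  then show "\<forall>\<^sub>F k in sequentially. K \<le> root k (seq_of q k)"
    using eventually_sequentially by blast
qed

lemma seq_of_in_LC: "seq_of q \<in> LC"
proof -
  have "(seq_of q j)\<^sup>2 \<le> seq_of q (j - 1) * seq_of q (j + 1)" if "1 \<le> j" for j
  proof -
    obtain i where i: "j = Suc i" using \<open>1 \<le> j\<close> by (cases j) auto
    have "q (Suc i) \<le> q (Suc (Suc i))" using mono_q by (simp add: mono_def)
    then have "(seq_of q i)\<^sup>2 * q (Suc i) * q (Suc i)
        \<le> (seq_of q i)\<^sup>2 * q (Suc i) * q (Suc (Suc i))"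
      using q_pos[of "Suc i"] by (intro mult_left_mono) auto
    then show ?thesis by (simp add: i power2_eq_square mult_ac)
  qed
  then show ?thesis
    using seq_of_pos q_ge_1 filterlim_root_seq_of by (auto simp: LC_def)
qed

text \<open>Quotients that grow at most polynomially give moderate growth, because the products of
  \<open>(j + i) / i\<close> that arise are binomial coefficients.\<close>

lemma moderate_growth_seq_of:
  assumes "\<And>i j. 1 \<le> i \<Longrightarrow> q (j + i) * real i ^ s \<le> q i * real (j + i) ^ s"
  shows "moderate_growth (seq_of q)"
proof -
  have binom: "seq_of q (j + k) \<le> seq_of q j * seq_of q k * real ((j + k) choose k) ^ s" for j k
  proof (induction k)
    case (Suc k)
    define B where "B = real ((j + k) choose k)"
    have B': "real ((j + Suc k) choose Suc k) = B * real (j + Suc k) / real (Suc k)"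
    proof -
      have "Suc (j + k) * ((j + k) choose k) = (Suc (j + k) choose Suc k) * Suc k"
        by (rule Suc_times_binomial_eq)
      then have "real (Suc (j + k)) * B = real (Suc (j + k) choose Suc k) * real (Suc k)"
        unfolding B_def by (metis of_nat_mult)
      then show ?thesis by (simp add: field_simps)
    qed
    have quot: "q (j + Suc k) \<le> q (Suc k) * (real (j + Suc k) / real (Suc k)) ^ s"
      using assms[of "Suc k" j] by (simp add: power_divide divide_simps)
    have "seq_of q (j + Suc k) = seq_of q (j + k) * q (j + Suc k)" by simp
    also have "\<dots> \<le> (seq_of q j * seq_of q k * B ^ s) *
        (q (Suc k) * (real (j + Suc k) / real (Suc k)) ^ s)"
      using Suc[folded B_def] quot q_pos[of "j + Suc k"] seq_of_pos[of j] seq_of_pos[of k]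
      by (intro mult_mono) (auto simp: B_def)
    also have "\<dots> = seq_of q j * seq_of q (Suc k) * real ((j + Suc k) choose Suc k) ^ s"
      unfolding B' by (simp add: power_mult_distrib power_divide)
    finally show ?case .
  qed simp
  have "seq_of q (j + k) \<le> (2 ^ s) ^ (j + k) * seq_of q j * seq_of q k" for j k
  proof -
    have "((j + k) choose k) \<le> 2 ^ (j + k)"
      by (rule binomial_le_pow2)
    then have "real ((j + k) choose k) \<le> 2 ^ (j + k)"
      by (metis of_nat_le_iff of_nat_numeral of_nat_power)
    then have "real ((j + k) choose k) ^ s \<le> (2 ^ (j + k)) ^ s"
      by (intro power_mono) auto
    then have "seq_of q j * seq_of q k * real ((j + k) choose k) ^ s
        \<le> seq_of q j * seq_of q k * (2 ^ (j + k)) ^ s"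
      using seq_of_pos[of j] seq_of_pos[of k] by (intro mult_left_mono) auto
    with binom[of j k] show ?thesis
      by (simp add: power_mult[symmetric] mult_ac)
  qed
  then show ?thesis
    unfolding moderate_growth_def by (intro exI[of _ "2 ^ s"]) simp
qed

lemma omega_upper:
  assumes "1 \<le> t" and "\<And>i. m < i \<Longrightarrow> t \<le> q i"
  shows "omega (seq_of q) t \<le> real m * ln t"
proof -
  have "ln (t ^ p / seq_of q p) \<le> real m * ln t" for p
  proof -
    have "t ^ p / seq_of q p \<le> t ^ m" using assms by (rule ratio_le)
    then have "ln (t ^ p / seq_of q p) \<le> ln (t ^ m)"
      using assms(1) seq_of_pos[of p] by (intro ln_mono) auto
    then show ?thesis using assms(1) by (simp add: ln_realpow)
  qed
  then show ?thesis
    using assms(1) by (auto simp: omega_def intro!: cSUP_least)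
qed

lemma omega_lower:
  assumes "1 \<le> t"
  shows "ln (t ^ p / seq_of q p) \<le> omega (seq_of q) t"
proof -
  obtain m where m: "\<And>i. m < i \<Longrightarrow> t \<le> q i" using eventually_ge[where K = t] by blast
  have "t ^ p / seq_of q p \<le> t ^ m" for p using assms m by (rule ratio_le)
  then have "ln (t ^ p / seq_of q p) \<le> ln (t ^ m)" for p
    using assms seq_of_pos[of p] by (intro ln_mono) auto
  then have "bdd_above (range (\<lambda>p. ln (t ^ p / seq_of q p)))"
    by (intro bdd_aboveI[of _ "ln (t ^ m)"]) auto
  then show ?thesis
    using assms by (auto simp: omega_def intro: cSUP_upper)
qed

end

section \<open>Long flat stretches force vanishing growth indices\<close>

text \<open>The quotients \<open>q\<close> take a constant value \<open>c\<close> on stretches \<open>{a<..b}\<close> for which \<open>b\<close> is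
  arbitrarily large relative to \<open>a\<close> and to \<open>a * ln c\<close>. The ratio \<open>b / a\<close> is what matters for
  the index of the sequence, the ratio \<open>b / (a * ln c)\<close> for that of the associated weight.\<close>

locale flat_quotients = quotients +
  assumes flat: "\<And>K. \<exists>a b c. 1 \<le> a \<and> a < b \<and> (\<forall>i\<in>{a<..b}. q i = c) \<and>
                   K * real a * (1 + ln c) \<le> real b"
begin

lemma not_gamma_cond: "\<not> gamma_cond (seq_of q) (seq_of q) r"
proof
  assume "gamma_cond (seq_of q) (seq_of q) r"
  then have fin: "(SUP p\<in>{1..}. ennreal (q p powr (1 / r) / real p) *
        (\<Sum>k. ennreal ((1 / q (p + k)) powr (1 / r)))) < \<infinity>" (is "?S < \<infinity>")
    by (simp add: gamma_cond_def mquot_seq_of)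
  define K where "K = enn2real ?S"
  have K: "?S = ennreal K" "0 \<le> K"
    using fin by (auto simp: K_def)
  obtain a b c where ab: "1 \<le> a" "a < b" and c: "\<And>i. i \<in> {a<..b} \<Longrightarrow> q i = c"
    and large: "(2 * K + 3) * real a * (1 + ln c) \<le> real b"
    using flat[of "2 * K + 3"] by auto
  have "1 \<le> c" using c[of b] ab q_ge_1[of b] by simp
  have "ennreal (q (Suc a) powr (1 / r) / real (Suc a)) *
        (\<Sum>k. ennreal ((1 / q (Suc a + k)) powr (1 / r))) \<le> ?S"
    by (rule SUP_upper) simp
  moreover have "(\<Sum>k<b - a. ennreal ((1 / q (Suc a + k)) powr (1 / r)))
      \<le> (\<Sum>k. ennreal ((1 / q (Suc a + k)) powr (1 / r)))"
    by (rule sum_le_suminf) auto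
  moreover have "(\<Sum>k<b - a. ennreal ((1 / q (Suc a + k)) powr (1 / r)))
      = ennreal (real (b - a) * (1 / c) powr (1 / r))"
  proof -
    have "(\<Sum>k<b - a. ennreal ((1 / q (Suc a + k)) powr (1 / r)))
        = (\<Sum>k<b - a. ennreal ((1 / c) powr (1 / r)))"
      using c by (intro sum.cong) auto
    then show ?thesis by (simp add: sum_ennreal ennreal_mult ennreal_of_nat_eq_real_of_nat)
  qed
  ultimately have "ennreal (c powr (1 / r) / real (Suc a)) *
      ennreal (real (b - a) * (1 / c) powr (1 / r)) \<le> ennreal K"
    using c[of "Suc a"] ab K(1) by (metis (no_types, lifting) Suc_leI greaterThanAtMost_iff
        lessI mult_left_mono order_trans zero_le)
  then have "ennreal ((c powr (1 / r) / real (Suc a)) * (real (b - a) * (1 / c) powr (1 / r)))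
      \<le> ennreal K"
    by (subst ennreal_mult) auto
  moreover have "(c powr (1 / r) / real (Suc a)) * (real (b - a) * (1 / c) powr (1 / r))
      = real (b - a) / real (Suc a)"
    using \<open>1 \<le> c\<close> by (simp add: powr_divide field_simps)
  ultimately have "real (b - a) / real (Suc a) \<le> K"
    using K(2) by (metis ennreal_le_iff)
  then have "real b - real a \<le> K * (real a + 1)"
    using ab by (simp add: field_simps of_nat_diff)
  moreover have "(2 * K + 3) * real a \<le> (2 * K + 3) * real a * (1 + ln c)"
    using K(2) \<open>1 \<le> c\<close> mult_left_mono[of 1 "1 + ln c" "(2 * K + 3) * real a"] by simp
  moreover have "K * 1 \<le> K * real a"
    using K(2) ab by (intro mult_left_mono) auto
  ultimately show False
    using large ab by (simp add: algebra_simps)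
qed

lemma gamma_seq_eq_0: "gamma_seq (seq_of q) = 0"
  by (simp add: gamma_seq_def gamma_mixed_def not_gamma_cond bot_ennreal)

text \<open>At the value \<open>c\<close> of a flat stretch the weight is at most \<open>a * ln c\<close>, but at \<open>c * u\<close> it
  is already at least \<open>b * ln u\<close>.\<close>

lemma omega_integral_unbounded:
  assumes "0 < r" "0 < C"
  shows "\<exists>t\<ge>0. \<not> (\<integral>\<^sup>+u\<in>{1..}. ennreal (omega (seq_of q) (t * u) / u powr (1 + 1 / r)) \<partial>lborel)
           \<le> ennreal (C * omega (seq_of q) t + C)"
proof -
  \<comment> \<open>The part of the integral over \<open>[2, 3]\<close> suffices: there the integrand is at least
    \<open>b * \<delta>\<close>.\<close>
  define \<delta> where "\<delta> = ln 2 / 3 powr (1 + 1 / r)"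
  have "0 < \<delta>" by (simp add: \<delta>_def)
  obtain a b c where ab: "1 \<le> a" "a < b" and c: "\<And>i. i \<in> {a<..b} \<Longrightarrow> q i = c"
    and large: "(C + 1) / \<delta> * real a * (1 + ln c) \<le> real b"
    using flat[of "(C + 1) / \<delta>"] by auto
  have "1 \<le> c" using c[of b] ab q_ge_1[of b] by simp
  have "q i \<le> c" if "i \<le> b" for i
    using monoD[OF mono_q that] c[of b] ab by simp
  then have seq_b: "seq_of q b \<le> c ^ b" by (rule seq_of_le_power)
  have "c \<le> q i" if "a < i" for i
    using monoD[OF mono_q, of "Suc a" i] c[of "Suc a"] ab that by simp
  then have upper: "omega (seq_of q) c \<le> real a * ln c"
    using \<open>1 \<le> c\<close> by (intro omega_upper)
  have lower: "real b * \<delta> \<le> omega (seq_of q) (c * u) / u powr (1 + 1 / r)" if u: "u \<in> {2..3}" for u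
  proof -
    have "2 ^ b \<le> u ^ b" using u by (intro power_mono) auto
    also have "u ^ b * seq_of q b \<le> u ^ b * c ^ b"
      using u seq_b by (intro mult_left_mono) auto
    then have "u ^ b \<le> (c * u) ^ b / seq_of q b"
      using seq_of_pos[of b] by (simp add: power_mult_distrib field_simps)
    finally have "ln (2 ^ b) \<le> ln ((c * u) ^ b / seq_of q b)"
      by (intro ln_mono) auto
    also have "1 * 1 \<le> c * u"
      using u \<open>1 \<le> c\<close> by (intro mult_mono) auto
    then have "ln ((c * u) ^ b / seq_of q b) \<le> omega (seq_of q) (c * u)"
      by (intro omega_lower) simp
    finally have num: "real b * ln 2 \<le> omega (seq_of q) (c * u)"
      by (simp add: ln_realpow)
    have den: "u powr (1 + 1 / r) \<le> 3 powr (1 + 1 / r)" "0 < u powr (1 + 1 / r)"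
      using u assms by (auto intro: powr_mono2)
    have "real b * ln 2 / 3 powr (1 + 1 / r) \<le> omega (seq_of q) (c * u) / u powr (1 + 1 / r)"
      using num den order_trans[OF _ num, of 0] by (intro frac_le) auto
    then show ?thesis by (simp add: \<delta>_def)
  qed
  have "ennreal (real b * \<delta>) = (\<integral>\<^sup>+u. ennreal (real b * \<delta>) * indicator {2..3::real} u \<partial>lborel)"
    by (simp add: nn_integral_cmult_indicator)
  also have "\<dots> \<le> (\<integral>\<^sup>+u\<in>{1..}. ennreal (omega (seq_of q) (c * u) / u powr (1 + 1 / r)) \<partial>lborel)"
    using lower by (intro nn_integral_mono) (auto simp: indicator_def intro: ennreal_leI)
  finally have integral: "ennreal (real b * \<delta>) \<le> \<dots>" .
  have "(C + 1) * (real a * (1 + ln c)) \<le> real b * \<delta>"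
    using large \<open>0 < \<delta>\<close> by (simp add: field_simps)
  moreover have "C * 1 \<le> C * real a" "0 \<le> real a * ln c" "C * omega (seq_of q) c \<le> C * (real a * ln c)"
    using ab assms upper \<open>1 \<le> c\<close> by auto
  ultimately have "C * omega (seq_of q) c + C < real b * \<delta>"
    using ab(1) unfolding distrib_left distrib_right by simp
  then have "ennreal (C * omega (seq_of q) c + C) < ennreal (real b * \<delta>)"
    using ab \<open>0 < \<delta>\<close> by (intro ennreal_lessI) auto
  with integral \<open>1 \<le> c\<close> show ?thesis
    by (intro exI[of _ c]) auto
qed

lemma gamma_weight_eq_0: "gamma_weight (omega (seq_of q)) = 0"
proof -
  have "{r. r > 0 \<and> (\<exists>C>0. \<forall>t\<ge>0.
      (\<integral>\<^sup>+u\<in>{1..}. ennreal (omega (seq_of q) (t * u) / u powr (1 + 1 / r)) \<partial>lborel)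
      \<le> ennreal (C * omega (seq_of q) t + C))} = {}"
    using omega_integral_unbounded by blast
  then show ?thesis
    unfolding gamma_weight_def by (simp only: image_empty Sup_empty bot_ennreal)
qed

end

section \<open>The two quotient sequences\<close>

text \<open>The break points are chosen to grow so fast that \<open>ln (slow b)\<close> is negligible against
  \<open>b\<close>, while each of them is still the fourth power of its predecessor.\<close>

definition brk :: "nat \<Rightarrow> nat" where
  "brk j = 2 ^ 4 ^ j"

lemma brk_0 [simp]: "brk 0 = 2"
  by (simp add: brk_def)

lemma brk_Suc: "brk (Suc j) = brk j ^ 4"
  unfolding brk_def power_Suc by (metis mult.commute power_mult)

lemma brk_ge_2: "2 \<le> brk j"
  unfolding brk_def by (rule self_le_power) simp_all

lemma brk_mono: "i \<le> j \<Longrightarrow> brk i \<le> brk j"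
  by (simp add: brk_def)

lemma less_brk: "j < brk j"
proof -
  have "j < 4 ^ j" by (rule less_exp[THEN less_le_trans]) (simp add: power_mono)
  also have "\<dots> < brk j" unfolding brk_def by (rule less_exp)
  finally show ?thesis .
qed

lemma brk_large: "\<exists>j. K * (1 + L * ln (real (brk j))) \<le> real (brk j)"
proof -
  have "\<forall>\<^sub>F t in at_top. K * (1 + L * ln t) \<le> (t::real)"
    by real_asymp
  then obtain T where T: "\<And>t. T \<le> t \<Longrightarrow> K * (1 + L * ln t) \<le> t"
    by (auto simp: eventually_at_top_linorder)
  obtain j where "T \<le> real j" using real_arch_simple by blast
  with less_brk[of j] have "T \<le> real (brk j)" by linarith
  with T show ?thesis by blast
qed

text \<open>The indices \<open>k\<close> for which the step from \<open>k\<close> to \<open>k + 1\<close> lies in a stretch of quadratic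
  growth.\<close>

definition rising :: "nat set" where
  "rising = (\<Union>j. {brk j ^ 2..<brk (Suc j)})"

text \<open>The quotients, up to a power, of the smaller sequence: constant on \<open>[b, b\<^sup>2]\<close> and
  proportional to the square of the index on \<open>[b\<^sup>2, b\<^sup>4]\<close>, for each break point \<open>b\<close>.\<close>

primrec slow :: "nat \<Rightarrow> real" where
  "slow 0 = 1"
| "slow (Suc k) = (if k \<in> rising then slow k * (real (Suc k) / real k)\<^sup>2 else slow k)"

lemma zero_notin_rising: "0 \<notin> rising"
proof -
  have "brk j \<noteq> 0" for j using brk_ge_2[of j] by linarith
  then show ?thesis by (auto simp: rising_def)
qed

lemma slow_le_Suc: "1 \<le> slow k \<and> slow k \<le> slow (Suc k)"
proof (induction k)
  case 0
  then show ?case by (simp add: zero_notin_rising)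
next
  case (Suc k)
  have "1 \<le> slow (Suc k)" using Suc by linarith
  moreover have "slow (Suc k) * 1 \<le> slow (Suc k) * (real (Suc (Suc k)) / real (Suc k))\<^sup>2"
    using \<open>1 \<le> slow (Suc k)\<close> by (intro mult_left_mono one_le_power) auto
  ultimately show ?case by (subst (2) slow.simps(2)) simp
qed

lemma slow_ge_1: "1 \<le> slow k"
  using slow_le_Suc[of k] by simp

lemma slow_pos: "0 < slow k"
  using slow_ge_1[of k] by linarith

lemma mono_slow: "mono slow"
  using slow_le_Suc by (simp add: mono_iff_le_Suc)

lemma slow_2: "slow 2 = 1"
proof -
  have "1 < brk j ^ 2" for j using brk_ge_2[of j] by (intro one_less_power) auto
  then have "1 \<notin> rising" by (auto simp: rising_def not_le)
  then show ?thesis by (simp add: numeral_2_eq_2 zero_notin_rising)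
qed

lemma slow_growth:
  assumes "1 \<le> k" "k \<le> m"
  shows "slow m * (real k)\<^sup>2 \<le> slow k * (real m)\<^sup>2"
  using assms(2)
proof (induction m rule: dec_induct)
  case (step m)
  have "0 < m" using step assms by simp
  show ?case
  proof (cases "m \<in> rising")
    case True
    have "slow m * (real k)\<^sup>2 * (real (Suc m) / real m)\<^sup>2
        \<le> slow k * (real m)\<^sup>2 * (real (Suc m) / real m)\<^sup>2"
      using step.IH by (intro mult_right_mono) auto
    then show ?thesis
      using True \<open>0 < m\<close> by (simp add: power_divide field_simps)
  next
    case False
    have "slow k * (real m)\<^sup>2 \<le> slow k * (real (Suc m))\<^sup>2"
      using slow_pos[of k] by (intro mult_left_mono power_mono) auto
    with False step.IH show ?thesis by simp
  qed
qed simp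

lemma slow_le_square: "1 \<le> m \<Longrightarrow> slow m \<le> (real m)\<^sup>2"
  using slow_growth[of 1 m] by (simp add: zero_notin_rising)

lemma ln_slow_le: "1 \<le> m \<Longrightarrow> ln (slow m) \<le> 2 * ln (real m)"
  using ln_mono[OF slow_le_square[of m] slow_pos] by (simp add: ln_realpow)

lemma slow_flat:
  assumes "brk j \<le> k" "k \<le> brk j ^ 2"
  shows "slow k = slow (brk j)"
  using assms
proof (induction k rule: dec_induct)
  case (step k)
  have "k \<notin> rising"
  proof
    assume "k \<in> rising"
    then obtain i where i: "brk i ^ 2 \<le> k" "k < brk (Suc i)" by (auto simp: rising_def)
    show False
    proof (cases "j \<le> i")
      case True
      then have "brk j ^ 2 \<le> brk i ^ 2" by (intro power_mono brk_mono) auto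
      with i step show False by simp
    next
      case False
      then have "brk (Suc i) \<le> brk j" by (intro brk_mono) simp
      with i step show False by simp
    qed
  qed
  with step show ?case by simp
qed simp

lemma slow_rising:
  assumes "brk j ^ 2 \<le> k" "k \<le> brk (Suc j)"
  shows "slow k = slow (brk j) * (real k)\<^sup>2 / real (brk j) ^ 4"
  using assms
proof (induction k rule: dec_induct)
  case base
  have "brk j \<le> brk j ^ 2" using brk_ge_2[of j] by (simp add: power2_eq_square)
  then show ?case
    using brk_ge_2[of j] by (subst slow_flat[of j]) auto
next
  case (step k)
  have "k \<in> rising" using step by (auto simp: rising_def intro!: exI[of _ j])
  moreover have "0 < k" using step brk_ge_2[of j]
    by (metis not_gr_zero not_numeral_le_zero le_zero_eq power_eq_0_iff)
  ultimately show ?case using step by (simp add: power_divide)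
qed

lemma slow_brk_Suc: "slow (brk (Suc j)) = slow (brk j) * real (brk (Suc j))"
proof -
  have "brk j ^ 2 \<le> brk (Suc j)"
    unfolding brk_Suc using brk_ge_2[of j] by (intro power_increasing) auto
  then have "slow (brk (Suc j)) = slow (brk j) * (real (brk (Suc j)))\<^sup>2 / real (brk j) ^ 4"
    by (intro slow_rising) auto
  moreover have "real (brk j) ^ 4 = real (brk (Suc j))" by (simp add: brk_Suc)
  ultimately show ?thesis using brk_ge_2[of "Suc j"] by (simp add: power2_eq_square)
qed

lemma slow_unbounded: "\<exists>m. K \<le> slow m"
proof -
  obtain j where j: "K \<le> real j" using real_arch_simple by blast
  have "real j \<le> real (brk (Suc j))" using less_brk[of "Suc j"] by simp
  also have "\<dots> \<le> slow (brk j) * real (brk (Suc j))"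
    using slow_ge_1[of "brk j"] by (simp add: mult_le_cancel_right1)
  finally show ?thesis using j slow_brk_Suc[of j] by (metis order_trans)
qed

lemma slow_le_linear:
  assumes "brk j \<le> p" "p \<le> brk (Suc j)"
  shows "slow p \<le> real p * slow (brk j)"
proof (cases "p \<le> brk j ^ 2")
  case True
  then show ?thesis
    using slow_flat[OF assms(1) True] slow_pos[of "brk j"] assms(1) brk_ge_2[of j]
    by (simp add: mult_le_cancel_right1)
next
  case False
  have "real p \<le> real (brk j) ^ 4"
    using assms(2) unfolding brk_Suc by (metis of_nat_le_iff of_nat_power)
  then have "real p * (slow (brk j) * real p) \<le> real (brk j) ^ 4 * (slow (brk j) * real p)"
    using slow_pos[of "brk j"] by (intro mult_right_mono) auto
  moreover have "0 < real (brk j) ^ 4" using brk_ge_2[of j] by simp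
  ultimately show ?thesis
    using slow_rising[of j p] False assms(2)
    by (simp add: pos_divide_le_eq power2_eq_square mult_ac)
qed

text \<open>The index of the first break point that is at least \<open>k\<close>; the stretches are closed on the
  right.\<close>

definition block :: "nat \<Rightarrow> nat" where
  "block k = (LEAST j. k \<le> brk j)"

text \<open>The quotients, up to a power, of the larger sequence: a step function that anticipates,
  on the whole stretch between two break points, the value that \<^const>\<open>slow\<close> takes at the end.\<close>

definition steps :: "nat \<Rightarrow> real" where
  "steps k = slow (brk (block k))"

lemma le_brk_block: "k \<le> brk (block k)"
  unfolding block_def by (rule LeastI[of _ k]) (simp add: less_brk less_imp_le)

lemma block_le: "k \<le> brk j \<Longrightarrow> block k \<le> j"
  unfolding block_def by (rule Least_le)

lemma block_eq:
  assumes "brk j < k" "k \<le> brk (Suc j)"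
  shows "block k = Suc j"
proof (rule antisym)
  show "block k \<le> Suc j" using assms by (intro block_le)
  have "\<not> block k \<le> j" using brk_mono[of "block k" j] le_brk_block[of k] assms by linarith
  then show "Suc j \<le> block k" by simp
qed

lemma mono_block: "mono block"
proof (rule monoI)
  fix i k :: nat assume "i \<le> k"
  then show "block i \<le> block k" using le_brk_block[of k] by (intro block_le) simp
qed

lemma mono_steps: "mono steps"
  unfolding steps_def by (intro monoI monoD[OF mono_slow] brk_mono monoD[OF mono_block])

lemma slow_le_steps: "slow k \<le> steps k"
  unfolding steps_def by (intro monoD[OF mono_slow] le_brk_block)

lemma steps_pos: "0 < steps k"
  by (simp add: steps_def slow_pos)

lemma steps_0: "steps 0 = 1"
proof -
  have "block 0 = 0" using block_le[of 0 0] by simp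
  then show ?thesis by (simp add: steps_def slow_2)
qed

text \<open>The reciprocals of the steps add up, over the stretch ending at the break point \<open>b\<close>, to
  at most \<open>b / slow b\<close>. These bounds at least halve from one stretch to the next, which the
  subtracted term records.\<close>

lemma sum_steps_to_brk:
  assumes "1 \<le> p"
  shows "(\<Sum>k=p..brk (block p + i). 1 / steps k)
    \<le> 2 * (real (brk (block p)) / steps p)
       - real (brk (block p + i)) / slow (brk (block p + i))"
proof (induction i)
  case 0
  have "(\<Sum>k=p..brk (block p). 1 / steps k) \<le> (\<Sum>k=p..brk (block p). 1 / steps p)"
    using monoD[OF mono_steps] steps_pos
    by (intro sum_mono divide_left_mono) auto
  also have "\<dots> = real (Suc (brk (block p)) - p) * (1 / steps p)" by simp
  also have "\<dots> \<le> real (brk (block p)) * (1 / steps p)"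
    using assms steps_pos[of p] by (intro mult_right_mono) auto
  finally show ?case by (simp add: steps_def)
next
  case (Suc i)
  define j where "j = block p + i"
  define s where "s = slow (brk j)"
  have s: "0 < s" by (simp add: s_def slow_pos)
  have p: "p \<le> brk j" using le_brk_block[of p] brk_mono[of "block p" j] by (simp add: j_def)
  have end_ratio: "real (brk (Suc j)) / slow (brk (Suc j)) = 1 / s"
    using s brk_ge_2[of "Suc j"] by (simp add: slow_brk_Suc s_def)
  have "(\<Sum>k=Suc (brk j)..brk (Suc j). 1 / steps k)
      = (\<Sum>k=Suc (brk j)..brk (Suc j). 1 / slow (brk (Suc j)))"
    by (intro sum.cong) (auto simp: steps_def block_eq[of j])
  also have "\<dots> \<le> real (brk (Suc j)) * (1 / slow (brk (Suc j)))"
    using slow_pos[of "brk (Suc j)"] by (simp add: divide_right_mono)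
  finally have stretch: "(\<Sum>k=Suc (brk j)..brk (Suc j). 1 / steps k) \<le> 1 / s"
    using end_ratio by simp
  have "{p..brk (Suc j)} = {p..brk j} \<union> {Suc (brk j)..brk (Suc j)}"
    using p brk_mono[of j "Suc j"] by auto
  then have "(\<Sum>k=p..brk (Suc j). 1 / steps k)
      = (\<Sum>k=p..brk j. 1 / steps k) + (\<Sum>k=Suc (brk j)..brk (Suc j). 1 / steps k)"
    by (simp only:) (intro sum.union_disjoint; auto)
  moreover have "2 / s \<le> real (brk j) / s"
    using s brk_ge_2[of j] by (intro divide_right_mono) auto
  moreover have "2 / s = 1 / s + 1 / s" by simp
  ultimately have "(\<Sum>k=p..brk (Suc j). 1 / steps k)
      \<le> 2 * (real (brk (block p)) / steps p) - real (brk (Suc j)) / slow (brk (Suc j))"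
    using Suc[folded j_def, folded s_def] stretch end_ratio by linarith
  then show ?case by (simp add: j_def)
qed

text \<open>The factor 2 is only needed in the first stretch, where \<open>p\<close> is 1 or 2 and \<open>slow p = 1\<close>.\<close>

lemma brk_block_ratio:
  assumes "1 \<le> p"
  shows "real (brk (block p)) / steps p \<le> 2 * (real p / slow p)"
proof (cases "block p")
  case 0
  have "p \<le> 2" using le_brk_block[of p] 0 by simp
  then have "slow p \<le> slow 2" using monoD[OF mono_slow] by blast
  moreover have "steps p = slow 2" by (simp add: steps_def 0)
  ultimately show ?thesis using slow_ge_1[of p] assms 0 by (simp add: slow_2)
next
  case (Suc j)
  have "brk j \<le> p" using block_le[of p j] Suc by linarith
  moreover have "p \<le> brk (Suc j)" using le_brk_block[of p] Suc by simp
  ultimately have "slow p \<le> real p * slow (brk j)" by (rule slow_le_linear)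
  then have "1 / slow (brk j) \<le> real p / slow p"
    using slow_pos[of p] slow_pos[of "brk j"] by (simp add: field_simps)
  moreover have "real (brk (block p)) / steps p = 1 / slow (brk j)"
    using brk_ge_2[of "Suc j"] by (simp add: steps_def Suc slow_brk_Suc)
  moreover have "0 \<le> real p / slow p" using slow_pos[of p] by simp
  ultimately show ?thesis by linarith
qed

lemma suminf_steps_le:
  assumes "1 \<le> p"
  shows "(\<Sum>k. ennreal (1 / steps (p + k))) \<le> ennreal (4 * (real p / slow p))"
proof (rule suminf_le_const)
  fix m
  \<comment> \<open>The break point with index \<open>block p + (p + m)\<close> exceeds its index and hence every summation
    index involved.\<close>
  have "(\<Sum>k<m. 1 / steps (p + k)) = (\<Sum>k=p..<p + m. 1 / steps k)"
    using sum.shift_bounds_nat_ivl[of "\<lambda>k. 1 / steps k" 0 p m]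
    by (simp add: atLeast0LessThan add.commute)
  also have "\<dots> \<le> (\<Sum>k=p..brk (block p + (p + m)). 1 / steps k)"
    using less_brk[of "block p + (p + m)"] steps_pos
    by (intro sum_mono2) (auto intro: less_imp_le)
  also have "\<dots> \<le> 2 * (real (brk (block p)) / steps p)
      - real (brk (block p + (p + m))) / slow (brk (block p + (p + m)))"
    by (rule sum_steps_to_brk[OF assms])
  also have "\<dots> \<le> 2 * (real (brk (block p)) / steps p)"
    using slow_pos by (simp add: less_imp_le)
  also have "\<dots> \<le> 4 * (real p / slow p)"
    using brk_block_ratio[OF assms] by linarith
  finally show "(\<Sum>k<m. ennreal (1 / steps (p + k))) \<le> ennreal (4 * (real p / slow p))"
    using steps_pos by (subst sum_ennreal) (auto intro: less_imp_le ennreal_leI)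
qed simp

section \<open>Powers of the two quotient sequences\<close>

lemma quotients_power:
  fixes x :: "nat \<Rightarrow> real"
  assumes "x 0 = 1" "mono x" "\<And>K. \<exists>m. K \<le> x m" "0 < n"
  shows "quotients (\<lambda>k. x k ^ n)"
proof (rule quotients.intro)
  have x: "1 \<le> x k" for k using monoD[OF assms(2), of 0 k] assms(1) by simp
  show "x 0 ^ n = 1" by (simp add: assms(1))
  show "mono (\<lambda>k. x k ^ n)"
  proof (rule monoI)
    fix i k :: nat assume "i \<le> k"
    then have "x i \<le> x k" by (rule monoD[OF assms(2)])
    moreover have "0 \<le> x i" using x[of i] by linarith
    ultimately show "x i ^ n \<le> x k ^ n" by (rule power_mono)
  qed
  show "\<exists>m. K \<le> x m ^ n" for K
  proof -
    obtain m where "K \<le> x m" using assms(3) by blast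
    also have "x m \<le> x m ^ n" using x assms(4) by (intro self_le_power)
    finally show ?thesis by blast
  qed
qed

lemma flat_slow:
  assumes "0 < n"
  shows "flat_quotients (\<lambda>k. slow k ^ n)"
proof -
  interpret quotients "\<lambda>k. slow k ^ n"
    by (rule quotients_power[OF slow.simps(1) mono_slow slow_unbounded assms])
  show ?thesis
  proof
    fix K :: real
    obtain j where j: "max K 0 * (1 + 2 * real n * ln (real (brk j))) \<le> real (brk j)"
      using brk_large[of "max K 0" "2 * real n"] by auto
    have pos: "1 \<le> brk j" "brk j < brk j ^ 2"
      using brk_ge_2[of j] by (auto simp: power2_eq_square)
    have "ln (slow (brk j) ^ n) \<le> 2 * real n * ln (real (brk j))"
      using mult_left_mono[OF ln_slow_le[OF pos(1)], of "real n"] slow_pos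
      by (simp add: ln_realpow mult_ac)
    moreover have "0 \<le> ln (slow (brk j) ^ n)"
      using slow_ge_1[of "brk j"] by simp
    ultimately have "K * (1 + ln (slow (brk j) ^ n))
        \<le> max K 0 * (1 + 2 * real n * ln (real (brk j)))"
      by (intro mult_mono) auto
    with j have "real (brk j) * (K * (1 + ln (slow (brk j) ^ n))) \<le> real (brk j) * real (brk j)"
      by (intro mult_left_mono) auto
    then have bound: "K * real (brk j) * (1 + ln (slow (brk j) ^ n)) \<le> real (brk j ^ 2)"
      by (simp add: power2_eq_square mult_ac)
    have const: "\<forall>i\<in>{brk j<..brk j ^ 2}. slow i ^ n = slow (brk j) ^ n"
    proof
      fix i assume "i \<in> {brk j<..brk j ^ 2}"
      then have "slow i = slow (brk j)" by (intro slow_flat) simp_all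
      then show "slow i ^ n = slow (brk j) ^ n" by (rule arg_cong)
    qed
    show "\<exists>a b c. 1 \<le> a \<and> a < b \<and> (\<forall>i\<in>{a<..b}. slow i ^ n = c) \<and>
        K * real a * (1 + ln c) \<le> real b"
      by (rule exI[of _ "brk j"], rule exI[of _ "brk j ^ 2"], rule exI[of _ "slow (brk j) ^ n"])
        (intro conjI pos const bound)
  qed
qed

lemma flat_steps:
  assumes "0 < n"
  shows "flat_quotients (\<lambda>k. steps k ^ n)"
proof -
  have "\<exists>m. K \<le> steps m" for K
    using slow_unbounded[of K] slow_le_steps order_trans by blast
  then interpret quotients "\<lambda>k. steps k ^ n"
    using quotients_power[OF steps_0 mono_steps _ assms] by blast
  show ?thesis
  proof
    fix K :: real
    obtain j where j: "max K 0 * (1 + 8 * real n * ln (real (brk j))) \<le> real (brk j)"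
      using brk_large[of "max K 0" "8 * real n"] by auto
    have pos: "1 \<le> brk j" "brk j ^ 1 < brk j ^ 4" "brk j ^ 2 \<le> brk j ^ 4" "1 \<le> brk (Suc j)"
      using brk_ge_2[of j] brk_ge_2[of "Suc j"] power_strict_increasing[of 1 4 "brk j"]
        power_increasing[of 2 4 "brk j"]
      by simp_all
    have "ln (real (brk (Suc j))) = 4 * ln (real (brk j))"
      using pos by (simp add: brk_Suc ln_realpow)
    then have "ln (slow (brk (Suc j)) ^ n) \<le> 8 * real n * ln (real (brk j))"
      using mult_left_mono[OF ln_slow_le[OF pos(4)], of "real n"] slow_pos
      by (simp add: ln_realpow mult_ac)
    moreover have "0 \<le> ln (slow (brk (Suc j)) ^ n)"
      using slow_ge_1[of "brk (Suc j)"] by simp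
    ultimately have "K * (1 + ln (slow (brk (Suc j)) ^ n))
        \<le> max K 0 * (1 + 8 * real n * ln (real (brk j)))"
      by (intro mult_mono) auto
    with j have "real (brk j) * (K * (1 + ln (slow (brk (Suc j)) ^ n))) \<le> real (brk j) * real (brk j)"
      by (intro mult_left_mono) auto
    also have "\<dots> \<le> real (brk (Suc j))"
      using pos(3) unfolding brk_Suc by (metis of_nat_le_iff of_nat_mult power2_eq_square)
    finally have bound: "K * real (brk j) * (1 + ln (slow (brk (Suc j)) ^ n)) \<le> real (brk (Suc j))"
      by (simp add: mult_ac)
    have const: "\<forall>i\<in>{brk j<..brk (Suc j)}. steps i ^ n = slow (brk (Suc j)) ^ n"
    proof
      fix i assume "i \<in> {brk j<..brk (Suc j)}"
      then have "block i = Suc j" by (intro block_eq) simp_all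
      then show "steps i ^ n = slow (brk (Suc j)) ^ n" by (simp only: steps_def)
    qed
    have less: "brk j < brk (Suc j)" using pos(2) by (simp only: brk_Suc power_one_right)
    show "\<exists>a b c. 1 \<le> a \<and> a < b \<and> (\<forall>i\<in>{a<..b}. steps i ^ n = c) \<and>
        K * real a * (1 + ln c) \<le> real b"
      by (rule exI[of _ "brk j"], rule exI[of _ "brk (Suc j)"],
          rule exI[of _ "slow (brk (Suc j)) ^ n"])
        (intro conjI pos(1) less const bound)
  qed
qed

lemma moderate_growth_slow:
  assumes "0 < n"
  shows "moderate_growth (seq_of (\<lambda>k. slow k ^ n))"
proof -
  interpret flat_quotients "\<lambda>k. slow k ^ n" using assms by (rule flat_slow)
  show ?thesis
  proof (rule moderate_growth_seq_of[where s = "2 * n"])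
    fix i j :: nat assume "1 \<le> i"
    then have "(slow (j + i) * (real i)\<^sup>2) ^ n \<le> (slow i * (real (j + i))\<^sup>2) ^ n"
      using slow_pos[of "j + i"] by (intro power_mono slow_growth) auto
    then show "slow (j + i) ^ n * real i ^ (2 * n) \<le> slow i ^ n * real (j + i) ^ (2 * n)"
      by (simp add: power_mult_distrib power_mult)
  qed
qed

lemma gamma_cond_slow_steps:
  assumes "0 < n"
  shows "gamma_cond (seq_of (\<lambda>k. slow k ^ n)) (seq_of (\<lambda>k. steps k ^ n)) (real n)"
proof -
  interpret M: flat_quotients "\<lambda>k. slow k ^ n" using assms by (rule flat_slow)
  interpret N: flat_quotients "\<lambda>k. steps k ^ n" using assms by (rule flat_steps)
  have cancel: "(z ^ n) powr (1 / real n) = z" if "0 < z" for z :: real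
    using that assms by (simp add: powr_realpow[symmetric] powr_powr)
  have "(1 / steps k ^ n) powr (1 / real n) = 1 / steps k" for k
    using cancel[of "1 / steps k"] steps_pos[of k] by (simp add: power_divide)
  then have "ennreal ((slow p ^ n) powr (1 / real n) / real p) *
      (\<Sum>k. ennreal ((1 / steps (p + k) ^ n) powr (1 / real n))) \<le> ennreal 4"
    if "p \<in> {1..}" for p
  proof -
    have p: "1 \<le> p" using that by simp
    have "ennreal (slow p / real p) * (\<Sum>k. ennreal (1 / steps (p + k)))
        \<le> ennreal (slow p / real p) * ennreal (4 * (real p / slow p))"
      using suminf_steps_le[OF p] by (intro mult_left_mono) auto
    also have "\<dots> = ennreal (slow p / real p * (4 * (real p / slow p)))"
      using slow_pos[of p] by (intro ennreal_mult[symmetric]) auto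
    also have "slow p / real p * (4 * (real p / slow p)) = 4"
      using p slow_pos[of p] by simp
    finally show ?thesis
      using \<open>\<And>k. (1 / steps k ^ n) powr (1 / real n) = 1 / steps k\<close> cancel slow_pos by simp
  qed
  then have "(SUP p\<in>{1..}. ennreal ((slow p ^ n) powr (1 / real n) / real p) *
      (\<Sum>k. ennreal ((1 / steps (p + k) ^ n) powr (1 / real n)))) \<le> ennreal 4"
    by (rule SUP_least)
  also have "\<dots> < \<infinity>" by simp
  finally show ?thesis
    by (simp add: gamma_cond_def M.mquot_seq_of N.mquot_seq_of)
qed

lemma gamma_mixed_slow_steps:
  assumes "0 < n"
  shows "ennreal (real n)
    \<le> gamma_mixed (seq_of (\<lambda>k. slow k ^ n)) (seq_of (\<lambda>k. steps k ^ n))"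
  unfolding gamma_mixed_def using gamma_cond_slow_steps[OF assms] assms
  by (intro SUP_upper) auto

theorem theoremA3:
  shows "(\<exists>M N. M \<in> LC \<and> N \<in> LC \<and>
            (\<exists>C\<ge>1. \<forall>p. mquot M p \<le> C * mquot N p) \<and>
            moderate_growth M \<and>
            gamma_mixed M N > 0 \<and>
            gamma_seq M = 0 \<and> gamma_seq N = 0 \<and>
            gamma_weight (omega M) = 0 \<and> gamma_weight (omega N) = 0) \<and>
         (\<forall>R::real. R > 0 \<longrightarrow>
           (\<exists>M N. M \<in> LC \<and> N \<in> LC \<and>
            (\<exists>C\<ge>1. \<forall>p. mquot M p \<le> C * mquot N p) \<and>
            moderate_growth M \<and>
            gamma_mixed M N \<ge> ennreal R \<and>
            gamma_seq M = 0 \<and> gamma_seq N = 0 \<and>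
            gamma_weight (omega M) = 0 \<and> gamma_weight (omega N) = 0))"
proof -
  have pair: "\<exists>M N. M \<in> LC \<and> N \<in> LC \<and>
            (\<exists>C\<ge>1. \<forall>p. mquot M p \<le> C * mquot N p) \<and>
            moderate_growth M \<and>
            gamma_mixed M N \<ge> ennreal R \<and>
            gamma_seq M = 0 \<and> gamma_seq N = 0 \<and>
            gamma_weight (omega M) = 0 \<and> gamma_weight (omega N) = 0"
    if "R > 0" for R :: real
  proof -
    obtain n where R: "R \<le> real n" using real_arch_simple by blast
    with that have n: "0 < n" by (cases n) auto
    interpret M: flat_quotients "\<lambda>k. slow k ^ n" using n by (rule flat_slow)
    interpret N: flat_quotients "\<lambda>k. steps k ^ n" using n by (rule flat_steps)
    have "slow p ^ n \<le> 1 * steps p ^ n" for p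
      using slow_le_steps[of p] slow_pos[of p] by (simp add: power_mono)
    then have le: "\<exists>C\<ge>1. \<forall>p. mquot (seq_of (\<lambda>k. slow k ^ n)) p
        \<le> C * mquot (seq_of (\<lambda>k. steps k ^ n)) p"
      unfolding M.mquot_seq_of N.mquot_seq_of by (intro exI[of _ 1]) simp
    have mixed: "ennreal R \<le> gamma_mixed (seq_of (\<lambda>k. slow k ^ n)) (seq_of (\<lambda>k. steps k ^ n))"
      using ennreal_leI[OF R] gamma_mixed_slow_steps[OF n] by (rule order_trans)
    show ?thesis
      by (rule exI[of _ "seq_of (\<lambda>k. slow k ^ n)"], rule exI[of _ "seq_of (\<lambda>k. steps k ^ n)"])
        (intro conjI M.seq_of_in_LC N.seq_of_in_LC le moderate_growth_slow[OF n] mixed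
          M.gamma_seq_eq_0 N.gamma_seq_eq_0 M.gamma_weight_eq_0 N.gamma_weight_eq_0)
  qed
  have pos: "0 < g" if "ennreal 1 \<le> g" for g
    by (rule less_le_trans[OF _ that]) simp
  show ?thesis
  proof (rule conjI)
    show "\<exists>M N. M \<in> LC \<and> N \<in> LC \<and>
            (\<exists>C\<ge>1. \<forall>p. mquot M p \<le> C * mquot N p) \<and>
            moderate_growth M \<and>
            gamma_mixed M N > 0 \<and>
            gamma_seq M = 0 \<and> gamma_seq N = 0 \<and>
            gamma_weight (omega M) = 0 \<and> gamma_weight (omega N) = 0"
      using pair[OF zero_less_one] by (elim ex_forward conj_forward) (assumption | rule pos)+
  qed (intro allI impI pair)
qed

end
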